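(* Let $M$ be a positive integer, let $\zeta > 0$, and let $\gamma \sim \mathrm{Gamma}(M,\zeta)$. Let $g(\gamma) = 1+\gamma$. Then for every $s \in \mathbb{R}$ the Mellin transform of $g(\gamma)$ is $$\mathcal{M}_{g(\gamma)}(s) = \zeta^{-M}\, U(M, M+s, \zeta^{-1}).$$
   Context: $\mathrm{Gamma}(M,\zeta)$ is the gamma distribution with shape parameter $M$ and scale parameter $\zeta$, i.e. with density $f_\gamma(x) = \frac{x^{M-1}e^{-x/\zeta}}{\Gamma(M)\zeta^M}$ for $x \ge 0$. The Mellin transform of a nonnegative random variable $X$ is $\mathcal{M}_X(s) = \mathbb{E}[X^{s-1}]$; it is considered for real $s$ for which the expectation exists. $U(a,b,z)$ is Tricomi's confluent hypergeometric function (of the second kind), given for $a>0$, $z>0$, $b\in\mathbb{R}$ by $U(a,b,z) = \frac{1}{\Gamma(a)}\int_0^\infty e^{-zt}t^{a-1}(1+t)^{b-a-1}\,\mathrm{d}t$. *)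

theory Defs
  imports "HOL-Probability.Probability"
begin

text \<open>
  The gamma density with shape \<open>k > 0\<close> and scale \<open>\<theta> > 0\<close>. Because \<open>0 powr 0 = 0\<close> in the
  library, its value at \<open>x = 0\<close> for \<open>k = 1\<close> is \<open>0\<close> rather than \<open>1 / \<theta>\<close>; this single point
  does not affect the distribution.
\<close>

definition gamma_density :: "real \<Rightarrow> real \<Rightarrow> real \<Rightarrow> real" where
  "gamma_density k \<theta> x =
     (if x < 0 then 0
      else x powr (k - 1) * exp (- x / \<theta>) / (Gamma k * \<theta> powr k))"

text \<open>
  The Bochner integral is \<open>0\<close> when the expectation does not exist, so this is meaningful only
  together with integrability of \<open>X powr (s - 1)\<close>. For \<open>s = 1\<close> it presupposes that \<open>X\<close> is
  almost surely positive, again since \<open>0 powr 0 = 0\<close>.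
\<close>

definition mellin_transform :: "'a measure \<Rightarrow> ('a \<Rightarrow> real) \<Rightarrow> real \<Rightarrow> real" where
  "mellin_transform P X s = (\<integral>\<omega>. X \<omega> powr (s - 1) \<partial>P)"

text \<open>Only the parameter range \<open>a > 0\<close>, \<open>z > 0\<close>, where the integral converges, is intended.\<close>

definition tricomi_U :: "real \<Rightarrow> real \<Rightarrow> real \<Rightarrow> real" where
  "tricomi_U a b z =
     1 / Gamma a *
     (LINT t:{0<..}|lborel. exp (- z * t) * t powr (a - 1) * (1 + t) powr (b - a - 1))"

end

theory Submission
  imports Defs
begin

text \<open>The expectation of (1 + \<gamma>)^(s-1) is the integral of (1 + x)^(s-1) against the
  gamma density. With a = M, b = M + s and z = 1/\<zeta>, the exponent b - a - 1 equals s - 1, so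
  this is already Tricomi's integral, up to the constant \<zeta>^(-M) / \<Gamma>(M); no substitution
  is involved (\<open>gamma_density_mult_powr\<close>). The analytic content is convergence for
  every real s (\<open>set_integrable_tricomi_U_integrand\<close>): a power of 1 + t grows more
  slowly than any exponential, so half of the decay of exp(-zt) absorbs it and a Gamma integrand of
  rate z/2 remains as a majorant.\<close>

lemma powr_one_plus_le_exp:
  fixes c r :: real
  assumes "c > 0"
  obtains K where "\<And>t. t > 0 \<Longrightarrow> (1 + t) powr r \<le> K * exp (c * t)"
proof
  \<comment> \<open>The inequality ln y \<le> y - 1 at y = k(1 + t) bounds ln (1 + t) by a line of
    slope k. This k makes \<open>\<bar>r\<bar> * k\<close> at most c; the added 1 covers r =
    0.\<close>
  define k where "k = c / (\<bar>r\<bar> + 1)"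
  have k: "k > 0" "\<bar>r\<bar> * k \<le> c"
    using assms by (auto simp: k_def field_simps)
  fix t :: real
  assume t: "t > 0"
  have "ln k + ln (1 + t) = ln (k * (1 + t))"
    using k t by (simp add: ln_mult)
  also have "\<dots> \<le> k * (1 + t) - 1"
    using k t by (intro ln_le_minus_one) simp
  finally have ln_le: "ln (1 + t) \<le> k * t + (k - 1 - ln k)"
    by (simp add: algebra_simps)
  \<comment> \<open>Since ln (1 + t) \<ge> 0 for t > 0, both signs of r are treated at once.\<close>
  have "r * ln (1 + t) \<le> \<bar>r\<bar> * ln (1 + t)"
    using t by (intro mult_right_mono) auto
  also have "\<dots> \<le> \<bar>r\<bar> * (k * t + (k - 1 - ln k))"
    using ln_le by (intro mult_left_mono) auto
  also have "\<dots> = \<bar>r\<bar> * k * t + \<bar>r\<bar> * (k - 1 - ln k)"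
    by (simp add: algebra_simps)
  also have "\<dots> \<le> c * t + \<bar>r\<bar> * (k - 1 - ln k)"
    using k t by simp
  finally show "(1 + t) powr r \<le> exp (\<bar>r\<bar> * (k - 1 - ln k)) * exp (c * t)"
    using t by (simp add: powr_def exp_add [symmetric] add.commute)
qed

text \<open>This is the absolute convergence of Euler's Gamma integral: the norm of the complex
  integrand at a real exponent is the real function here.\<close>

lemma set_integrable_powr_exp:
  fixes a z :: real
  assumes "a > 0" "z > 0"
  shows "set_integrable lborel {0<..} (\<lambda>t. t powr (a - 1) * exp (- z * t))"
proof -
  let ?f = "\<lambda>t. complex_of_real t powr (of_real a - 1) / of_real (exp (z * t))"
  have "?f absolutely_integrable_on {0<..}"
    using assms by (intro absolutely_integrable_Gamma_integral) auto
  then have "(\<lambda>t. norm (?f t)) absolutely_integrable_on {0<..}"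
    by (rule absolutely_integrable_norm[unfolded o_def])
  also have "?this \<longleftrightarrow> set_integrable lebesgue {0<..} (\<lambda>t. t powr (a - 1) * exp (- z * t))"
    by (intro set_integrable_cong)
       (auto simp: norm_divide norm_mult norm_inverse norm_powr_real_powr exp_minus divide_inverse)
  finally show ?thesis
    \<comment> \<open>\<open>lebesgue\<close> is the completion of \<open>lborel\<close>, and for
      Borel functions integrability over the two agrees.\<close>
    unfolding set_integrable_def by (subst (asm) integrable_completion) simp_all
qed

lemma set_integrable_tricomi_U_integrand:
  fixes a z r :: real
  assumes "a > 0" "z > 0"
  shows "set_integrable lborel {0<..} (\<lambda>t. exp (- z * t) * t powr (a - 1) * (1 + t) powr r)"
proof -
  obtain K where K: "\<And>t. t > 0 \<Longrightarrow> (1 + t) powr r \<le> K * exp (z / 2 * t)"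
    using powr_one_plus_le_exp[of "z / 2"] assms by auto
  have "set_integrable lborel {0<..} (\<lambda>t. K * (t powr (a - 1) * exp (- (z / 2) * t)))"
    using assms by (intro set_integrable_mult_right set_integrable_powr_exp) auto
  then show ?thesis
  proof (rule set_integrable_bound)
    have "exp (- z * t) * t powr (a - 1) * (1 + t) powr r
            \<le> K * (t powr (a - 1) * exp (- (z / 2) * t))" if "t > 0" for t
    proof -
      have "exp (- z * t) * t powr (a - 1) * (1 + t) powr r
              \<le> exp (- z * t) * t powr (a - 1) * (K * exp (z / 2 * t))"
        using K[OF that] by (intro mult_left_mono) auto
      also have "\<dots> = K * (t powr (a - 1) * (exp (- z * t) * exp (z / 2 * t)))"
        by (simp only: mult_ac)
      also have "exp (- z * t) * exp (z / 2 * t) = exp (- (z / 2) * t)"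
        by (simp add: exp_add [symmetric])
      finally show ?thesis .
    qed
    then show "AE t in lborel. t \<in> {0<..} \<longrightarrow>
        norm (exp (- z * t) * t powr (a - 1) * (1 + t) powr r)
          \<le> norm (K * (t powr (a - 1) * exp (- (z / 2) * t)))"
      \<comment> \<open>The left side is nonnegative, and passing to the absolute value on the right
        avoids a separate argument for the sign of \<open>K\<close>.\<close>
      by (intro AE_I2) (force intro: order_trans[OF _ abs_ge_self])
  qed (simp add: set_borel_measurable_def)
qed

lemma gamma_density_nonneg:
  assumes "k > 0" "\<theta> > 0"
  shows "gamma_density k \<theta> x \<ge> 0"
  using assms by (auto simp: gamma_density_def intro!: divide_nonneg_nonneg mult_nonneg_nonneg)

text \<open>The identity is pointwise even at x = 0, where \<open>0 powr (k - 1) = 0\<close> makes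
  the density vanish, so the open half-line of \<open>tricomi_U\<close> fits exactly.\<close>

lemma gamma_density_mult_powr:
  "gamma_density k \<theta> x * (1 + x) powr r =
     indicator {0<..} x *
       (\<theta> powr (- k) / Gamma k * (exp (- inverse \<theta> * x) * x powr (k - 1) * (1 + x) powr r))"
  by (auto simp: gamma_density_def indicator_def powr_minus divide_simps)

theorem theorem1:
  fixes P :: "'a measure" and \<gamma> :: "'a \<Rightarrow> real"
    and M :: nat and \<zeta> :: real
  assumes "prob_space P"
    and "M \<ge> 1" and "\<zeta> > 0"
    and "distributed P lborel \<gamma> (\<lambda>x. ennreal (gamma_density (real M) \<zeta> x))"
  shows "\<forall>s::real.
           integrable P (\<lambda>\<omega>. (1 + \<gamma> \<omega>) powr (s - 1)) \<and>
           mellin_transform P (\<lambda>\<omega>. 1 + \<gamma> \<omega>) s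
             = \<zeta> powi (- int M) * tricomi_U (real M) (real M + s) (inverse \<zeta>)"
proof
  fix s :: real
  let ?I = "\<lambda>t. exp (- inverse \<zeta> * t) * t powr (real M - 1) * (1 + t) powr (s - 1)"
  let ?C = "\<zeta> powr (- real M) / Gamma (real M)"
  have nonneg: "gamma_density (real M) \<zeta> x \<ge> 0" for x
    using assms by (intro gamma_density_nonneg) auto
  have density: "gamma_density (real M) \<zeta> x * (1 + x) powr (s - 1)
                   = indicator {0<..} x *\<^sub>R (?C * ?I x)" for x
    by (simp add: gamma_density_mult_powr)
  have "set_integrable lborel {0<..} (\<lambda>t. ?C * ?I t)"
    using assms by (intro set_integrable_mult_right set_integrable_tricomi_U_integrand) auto
  then have "integrable lborel (\<lambda>x. gamma_density (real M) \<zeta> x * (1 + x) powr (s - 1))"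
    by (simp only: density set_integrable_def)
  then have "integrable P (\<lambda>\<omega>. (1 + \<gamma> \<omega>) powr (s - 1))"
    using distributed_integrable[OF assms(4), of "\<lambda>x. (1 + x) powr (s - 1)"] nonneg by simp
  moreover have "mellin_transform P (\<lambda>\<omega>. 1 + \<gamma> \<omega>) s
                   = (LINT x|lborel. gamma_density (real M) \<zeta> x * (1 + x) powr (s - 1))"
    using distributed_integral[OF assms(4), of "\<lambda>x. (1 + x) powr (s - 1)"] nonneg
    by (simp add: mellin_transform_def)
  then have "mellin_transform P (\<lambda>\<omega>. 1 + \<gamma> \<omega>) s = ?C * (LINT t:{0<..}|lborel. ?I t)"
    by (simp only: density set_lebesgue_integral_def [symmetric] set_integral_mult_right)
  \<comment> \<open>The factor 1 / \<Gamma>(M) in \<open>?C\<close> is the prefactor of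
    \<open>tricomi_U\<close>; what remains is \<zeta>^(-M), turned from a real into an integer
    power.\<close>
  then have "mellin_transform P (\<lambda>\<omega>. 1 + \<gamma> \<omega>) s
               = \<zeta> powi (- int M) * tricomi_U (real M) (real M + s) (inverse \<zeta>)"
    using assms(3) by (simp add: tricomi_U_def powr_minus powr_realpow power_int_minus)
  ultimately show "integrable P (\<lambda>\<omega>. (1 + \<gamma> \<omega>) powr (s - 1)) \<and>
      mellin_transform P (\<lambda>\<omega>. 1 + \<gamma> \<omega>) s
        = \<zeta> powi (- int M) * tricomi_U (real M) (real M + s) (inverse \<zeta>)"
    by blast
qed

end
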